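(* Let $\mathbf{k}$ be a commutative ring, $q\in\mathbf{k}$ and $r:=q+1$. Let $n\in\mathbb{N}$ and let $\beta\in\mathrm{Comp}_n$ be a composition. Then, in $\mathrm{QSym}$, $$r^{\ell(\beta)}M_\beta=\sum_{\alpha\in\mathrm{Comp}_n;\ D(\alpha)\subseteq D(\beta)}(-1)^{\ell(\beta)-\ell(\alpha)}\,\eta_\alpha^{(q)}.$$
   Context: $\mathbb{N}=\{0,1,2,\ldots\}$; for an integer $m$, $[m]=\{1,2,\ldots,m\}$ (empty if $m\le 0$). A composition is a finite tuple $\alpha=(\alpha_1,\ldots,\alpha_k)$ of positive integers; its length is $\ell(\alpha)=k$, its size is $|\alpha|=\alpha_1+\cdots+\alpha_k$. $\mathrm{Comp}$ is the set of all compositions (including the empty one), and $\mathrm{Comp}_n$ the set of compositions of size $n$. For $\alpha=(\alpha_1,\ldots,\alpha_k)\in\mathrm{Comp}_n$ set $D(\alpha)=\{\alpha_1+\cdots+\alpha_i \mid i\in[k-1]\}\subseteq[n-1]$. $\mathrm{QSym}\subseteq\mathbf{k}[[x_1,x_2,\ldots]]$ is the algebra of quasisymmetric functions over $\mathbf{k}$, with $\mathbf{k}$-basis $(M_\alpha)_{\alpha\in\mathrm{Comp}}$ where $M_\alpha=\sum_{i_1<i_2<\cdots<i_\ell}x_{i_1}^{\alpha_1}\cdots x_{i_\ell}^{\alpha_\ell}$ for $\alpha=(\alpha_1,\ldots,\alpha_\ell)$. For $\alpha\in\mathrm{Comp}_n$, $\eta_\alpha^{(q)}=\sum_{\beta\in\mathrm{Comp}_n;\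 D(\beta)\subseteq D(\alpha)}r^{\ell(\beta)}M_\beta\in\mathrm{QSym}$. *)

theory Defs
  imports "HOL-Library.Poly_Mapping"
begin

section \<open>Compositions\<close>

definition Comp :: "nat \<Rightarrow> nat list set" where
  "Comp n = {\<alpha>. 0 \<notin> set \<alpha> \<and> sum_list \<alpha> = n}"

definition D :: "nat list \<Rightarrow> nat set" where
  "D \<alpha> = {sum_list (take i \<alpha>) | i. i \<in> {1..length \<alpha> - 1}}"

lemma finite_Comp: "finite (Comp n)"
proof (rule finite_subset)
  have "length xs \<le> sum_list xs" if "0 \<notin> set xs" for xs :: "nat list"
    using that by (induction xs) auto
  then show "Comp n \<subseteq> {xs. set xs \<subseteq> {..n} \<and> length xs \<le> n}"
    unfolding Comp_def using member_le_sum_list by fastforce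
  show "finite {xs. set xs \<subseteq> {..n} \<and> length xs \<le> n}"
    by (rule finite_lists_length_le) simp
qed

lemma card_D:
  assumes "\<alpha> \<in> Comp n"
  shows "card (D \<alpha>) = length \<alpha> - 1"
proof -
  have pos: "0 \<notin> set \<alpha>" using assms by (simp add: Comp_def)
  have less: "sum_list (take i \<alpha>) < sum_list (take j \<alpha>)" if "i < j" "j \<le> length \<alpha>" for i j
    using that
  proof (induction j)
    case (Suc j)
    have "\<alpha> ! j \<in> set \<alpha>" using Suc.prems by simp
    then have "0 < \<alpha> ! j" using pos by (cases "\<alpha> ! j = 0") auto
    moreover have "sum_list (take (Suc j) \<alpha>) = sum_list (take j \<alpha>) + \<alpha> ! j"
      using Suc.prems by (simp add: take_Suc_conv_app_nth)
    ultimately show ?case using Suc by (cases "i = j") auto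
  qed simp
  have "inj_on (\<lambda>i. sum_list (take i \<alpha>)) {1..length \<alpha> - 1}"
  proof (rule inj_onI)
    fix i j
    assume ij: "i \<in> {1..length \<alpha> - 1}" "j \<in> {1..length \<alpha> - 1}"
      and eq: "sum_list (take i \<alpha>) = sum_list (take j \<alpha>)"
    have "i \<le> length \<alpha>" "j \<le> length \<alpha>" using ij by auto
    then have "\<not> i < j" "\<not> j < i" using less[of i j] less[of j i] eq by auto
    then show "i = j" by simp
  qed
  moreover have "D \<alpha> = (\<lambda>i. sum_list (take i \<alpha>)) ` {1..length \<alpha> - 1}"
    unfolding D_def by auto
  ultimately show ?thesis by (simp add: card_image)
qed

text \<open>Hence a natural-number difference \<open>length \<beta> - length \<alpha>\<close> is not truncated
  when \<open>D \<alpha> \<subseteq> D \<beta>\<close>.\<close>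

lemma length_le_if_D_subset:
  assumes "\<alpha> \<in> Comp n" "\<beta> \<in> Comp n" "D \<alpha> \<subseteq> D \<beta>"
  shows "length \<alpha> \<le> length \<beta>"
proof -
  have "finite (D \<beta>)" unfolding D_def by simp
  then have "length \<alpha> - 1 \<le> length \<beta> - 1"
    using card_mono[OF _ assms(3)] card_D[OF assms(1)] card_D[OF assms(2)] by simp
  moreover have "length \<alpha> = 0 \<longleftrightarrow> length \<beta> = 0"
    using assms(1,2) by (cases \<alpha>; cases \<beta>) (auto simp: Comp_def)
  ultimately show ?thesis by linarith
qed


section \<open>Formal power series in countably many variables\<close>

text \<open>The variables \<open>x\<^sub>1, x\<^sub>2, \<dots>\<close> are indexed by \<open>nat\<close> starting from 0, a monomial is a finitely
  supported exponent vector, and a power series is its family of coefficients.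
  Only the module structure is introduced.\<close>

typedef 'k power_series = "UNIV :: ((nat \<Rightarrow>\<^sub>0 nat) \<Rightarrow> 'k) set"
  morphisms coeff Abs_power_series ..

setup_lifting type_definition_power_series

instantiation power_series :: (ab_group_add) ab_group_add
begin

lift_definition zero_power_series :: "'a power_series" is "\<lambda>_. 0" .
lift_definition plus_power_series :: "'a power_series \<Rightarrow> 'a power_series \<Rightarrow> 'a power_series"
  is "\<lambda>f g m. f m + g m" .
lift_definition minus_power_series :: "'a power_series \<Rightarrow> 'a power_series \<Rightarrow> 'a power_series"
  is "\<lambda>f g m. f m - g m" .
lift_definition uminus_power_series :: "'a power_series \<Rightarrow> 'a power_series"
  is "\<lambda>f m. - f m" .

instance
  by standard (transfer; simp add: fun_eq_iff algebra_simps)+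

end

lift_definition scale :: "'k::times \<Rightarrow> 'k power_series \<Rightarrow> 'k power_series" (infixr "\<cdot>" 75)
  is "\<lambda>c f m. c * f m" .

text \<open>\<open>monomial [i\<^sub>1, \<dots>, i\<^sub>l] [a\<^sub>1, \<dots>, a\<^sub>l]\<close> is the exponent vector of
  \<open>x\<^bsub>i\<^sub>1\<^esub>\<^bsup>a\<^sub>1\<^esup> \<cdots> x\<^bsub>i\<^sub>l\<^esub>\<^bsup>a\<^sub>l\<^esup>\<close>.\<close>

definition monomial :: "nat list \<Rightarrow> nat list \<Rightarrow> (nat \<Rightarrow>\<^sub>0 nat)" where
  "monomial is \<alpha> = sum_list (map2 Poly_Mapping.single is \<alpha>)"

definition degree :: "(nat \<Rightarrow>\<^sub>0 nat) \<Rightarrow> nat" where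
  "degree m = (\<Sum>i\<in>Poly_Mapping.keys m. Poly_Mapping.lookup m i)"


section \<open>Quasisymmetric functions\<close>

definition QSym :: "'k::zero power_series set" where
  "QSym = {f. (\<exists>d. \<forall>m. coeff f m \<noteq> 0 \<longrightarrow> degree m \<le> d) \<and>
     (\<forall>\<alpha> is js. 0 \<notin> set \<alpha> \<and> length is = length \<alpha> \<and> length js = length \<alpha> \<and>
        sorted_wrt (<) is \<and> sorted_wrt (<) js \<longrightarrow>
        coeff f (monomial is \<alpha>) = coeff f (monomial js \<alpha>))}"

text \<open>The infinite sum defining \<open>M\<^sub>\<alpha>\<close> is taken coefficientwise: each tuple
  \<open>i\<^sub>1 < \<dots> < i\<^sub>l\<close> whose monomial is \<open>m\<close> contributes 1 to the coefficient of \<open>m\<close>.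
  For a composition \<open>\<alpha>\<close> there is at most one such tuple (see \<open>monomial_eq_iff\<close> below).\<close>

lift_definition M :: "nat list \<Rightarrow> 'k::{comm_monoid_add, one} power_series" is
  "\<lambda>\<alpha> m. \<Sum>is\<in>{is. length is = length \<alpha> \<and> sorted_wrt (<) is \<and> monomial is \<alpha> = m}. 1" .

text \<open>The class \<open>comm_ring_1\<close> would exclude the zero ring, so commutative rings with unity are
  represented by the sort \<open>{comm_ring, comm_monoid_mult}\<close>.\<close>

definition eta :: "'k::{comm_ring, comm_monoid_mult} \<Rightarrow> nat list \<Rightarrow> 'k power_series" where
  "eta q \<alpha> = (let r = q + 1 in
     \<Sum>\<beta>\<in>{\<beta> \<in> Comp (sum_list \<alpha>). D \<beta> \<subseteq> D \<alpha>}. r ^ length \<beta> \<cdot> M \<beta>)"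


subsection \<open>Membership in the module of quasisymmetric functions\<close>

text \<open>Since \<open>QSym\<close> is a submodule of the power series and contains all \<open>M \<alpha>\<close> and \<open>eta q \<alpha>\<close>,
  an identity between linear combinations of these is an identity in \<open>QSym\<close>.\<close>

lemma lookup_monomial_notin:
  "i \<notin> set is \<Longrightarrow> Poly_Mapping.lookup (monomial is \<alpha>) i = 0"
proof (induction "is" arbitrary: \<alpha>)
  case (Cons j "is")
  then show ?case
    by (cases \<alpha>) (auto simp: monomial_def lookup_add lookup_single_not_eq)
qed (simp add: monomial_def)

lemma lookup_monomial_nth:
  assumes "length is = length \<alpha>" "distinct is" "k < length \<alpha>"
  shows "Poly_Mapping.lookup (monomial is \<alpha>) (is ! k) = \<alpha> ! k"
  using assms
proof (induction "is" \<alpha> arbitrary: k rule: list_induct2)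
  case (Cons i "is" a \<alpha>)
  have eq: "monomial (i # is) (a # \<alpha>) = Poly_Mapping.single i a + monomial is \<alpha>"
    by (simp add: monomial_def)
  show ?case
  proof (cases k)
    case 0
    then show ?thesis
      using Cons.prems by (simp add: eq lookup_add lookup_monomial_notin)
  next
    case (Suc l)
    then have "is ! l \<in> set is" using Cons.prems Cons.hyps by simp
    then have "is ! l \<noteq> i" using Cons.prems by auto
    then show ?thesis
      using Cons.prems Cons.IH[of l] Suc by (simp add: eq lookup_add lookup_single_not_eq)
  qed
qed simp

lemma keys_monomial:
  assumes "length is = length \<alpha>" "distinct is" "0 \<notin> set \<alpha>"
  shows "Poly_Mapping.keys (monomial is \<alpha>) = set is"
proof -
  have "Poly_Mapping.lookup (monomial is \<alpha>) i \<noteq> 0" if i: "i \<in> set is" for i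
  proof -
    obtain k where "k < length is" "i = is ! k" using i by (metis in_set_conv_nth)
    moreover have "\<alpha> ! k \<in> set \<alpha>" using \<open>k < length is\<close> assms(1) by simp
    ultimately show ?thesis
      using lookup_monomial_nth[OF assms(1,2), of k] assms(1,3) \<open>k < length is\<close> \<open>i = is ! k\<close>
      by (cases "\<alpha> ! k = 0") simp_all
  qed
  then have "i \<in> set is \<longleftrightarrow> Poly_Mapping.lookup (monomial is \<alpha>) i \<noteq> 0" for i
    using lookup_monomial_notin[of i "is" \<alpha>] by (cases "i \<in> set is") simp_all
  then show ?thesis
    by (intro set_eqI) (simp only: in_keys_iff)
qed

lemma degree_monomial:
  assumes "length is = length \<alpha>" "distinct is" "0 \<notin> set \<alpha>"
  shows "degree (monomial is \<alpha>) = sum_list \<alpha>"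
proof -
  have "degree (monomial is \<alpha>) = sum_list (map (Poly_Mapping.lookup (monomial is \<alpha>)) is)"
    unfolding degree_def keys_monomial[OF assms]
    using assms(2) by (simp add: sum_list_distinct_conv_sum_set)
  also have "map (Poly_Mapping.lookup (monomial is \<alpha>)) is = \<alpha>"
    using assms(1) lookup_monomial_nth[OF assms(1,2)] by (intro nth_equalityI) simp_all
  finally show ?thesis .
qed

lemma monomial_eq_iff:
  assumes "length is = length \<alpha>" "sorted_wrt (<) is" "0 \<notin> set \<alpha>"
    and "length js = length \<beta>" "sorted_wrt (<) js" "0 \<notin> set \<beta>"
  shows "monomial is \<alpha> = monomial js \<beta> \<longleftrightarrow> is = js \<and> \<alpha> = \<beta>"
proof
  assume eq: "monomial is \<alpha> = monomial js \<beta>"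
  have d: "distinct is" "distinct js"
    using iffD1[OF strict_sorted_iff assms(2)] iffD1[OF strict_sorted_iff assms(5)] by blast+
  have "set is = set js"
    using keys_monomial[OF assms(1) d(1) assms(3)] keys_monomial[OF assms(4) d(2) assms(6)] eq
    by simp
  then have "is = js"
    using strict_sorted_equal[OF assms(2,5)] by simp
  moreover have "\<alpha> = \<beta>"
  proof (rule nth_equalityI)
    show "length \<alpha> = length \<beta>" using \<open>is = js\<close> assms(1,4) by simp
    then show "\<alpha> ! k = \<beta> ! k" if "k < length \<alpha>" for k
      using that eq \<open>is = js\<close> lookup_monomial_nth[OF assms(1) d(1), of k]
        lookup_monomial_nth[OF assms(4) d(2), of k] by simp
  qed
  ultimately show "is = js \<and> \<alpha> = \<beta>" ..
qed simp

lemma coeff_M_monomial: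
  assumes "0 \<notin> set \<beta>" "length js = length \<alpha>" "sorted_wrt (<) js" "0 \<notin> set \<alpha>"
  shows "coeff (M \<beta>) (monomial js \<alpha>) = (if \<alpha> = \<beta> then 1 else 0)"
proof -
  let ?S = "{is. length is = length \<beta> \<and> sorted_wrt (<) is \<and> monomial is \<beta> = monomial js \<alpha>}"
  have *: "is \<in> ?S \<longleftrightarrow> is = js \<and> \<alpha> = \<beta>" for "is"
    using monomial_eq_iff[OF _ _ assms(1) assms(2-4), of "is"] assms(2,3) by blast
  show ?thesis
  proof (cases "\<alpha> = \<beta>")
    case True
    then have S: "?S = {js}" using * by (intro set_eqI) simp
    show ?thesis unfolding M.rep_eq S using True by simp
  next
    case False
    then have S: "?S = {}" using * by (intro set_eqI) simp
    show ?thesis unfolding M.rep_eq S using False by simp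
  qed
qed

lemma QSymI:
  assumes "\<And>m. coeff f m \<noteq> 0 \<Longrightarrow> degree m \<le> d"
    and "\<And>\<alpha> is js. 0 \<notin> set \<alpha> \<Longrightarrow> length is = length \<alpha> \<Longrightarrow> length js = length \<alpha> \<Longrightarrow>
      sorted_wrt (<) is \<Longrightarrow> sorted_wrt (<) js \<Longrightarrow>
      coeff f (monomial is \<alpha>) = coeff f (monomial js \<alpha>)"
  shows "f \<in> QSym"
  unfolding QSym_def using assms by blast

lemma QSym_bounded:
  assumes "f \<in> QSym"
  obtains d where "\<And>m. coeff f m \<noteq> 0 \<Longrightarrow> degree m \<le> d"
  using assms unfolding QSym_def by blast

lemma QSym_quasisymmetric:
  assumes "f \<in> QSym" "0 \<notin> set \<alpha>" "length is = length \<alpha>" "length js = length \<alpha>"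
    "sorted_wrt (<) is" "sorted_wrt (<) js"
  shows "coeff f (monomial is \<alpha>) = coeff f (monomial js \<alpha>)"
  using assms unfolding QSym_def by blast

lemma M_in_QSym:
  assumes "\<beta> \<in> Comp n"
  shows "(M \<beta> :: 'k::{comm_monoid_add, one} power_series) \<in> QSym"
proof (rule QSymI)
  have pos: "0 \<notin> set \<beta>" using assms by (simp add: Comp_def)
  show "degree m \<le> n" if nz: "coeff (M \<beta> :: 'k power_series) m \<noteq> 0" for m
  proof -
    have "{is. length is = length \<beta> \<and> sorted_wrt (<) is \<and> monomial is \<beta> = m} \<noteq> {}"
    proof
      assume "{is. length is = length \<beta> \<and> sorted_wrt (<) is \<and> monomial is \<beta> = m} = {}"
      then show False using nz unfolding M.rep_eq by (simp only: sum.empty not_True_eq_False simp_thms)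
    qed
    then obtain "is" where *: "length is = length \<beta>" "sorted_wrt (<) is" "monomial is \<beta> = m"
      by blast
    have "distinct is" using iffD1[OF strict_sorted_iff *(2)] by blast
    then show ?thesis using degree_monomial[OF *(1) _ pos] *(3) assms unfolding Comp_def by simp
  qed
  show "coeff (M \<beta> :: 'k power_series) (monomial is \<alpha>) = coeff (M \<beta>) (monomial js \<alpha>)"
    if "0 \<notin> set \<alpha>" "length is = length \<alpha>" "length js = length \<alpha>"
      "sorted_wrt (<) is" "sorted_wrt (<) js" for \<alpha> "is" js
    unfolding coeff_M_monomial[OF pos that(2,4,1)] coeff_M_monomial[OF pos that(3,5,1)] ..
qed

lemma zero_in_QSym: "(0 :: 'k::ab_group_add power_series) \<in> QSym"
  by (rule QSymI) (simp_all add: zero_power_series.rep_eq)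

lemma add_in_QSym:
  fixes f g :: "'k::ab_group_add power_series"
  assumes "f \<in> QSym" "g \<in> QSym"
  shows "f + g \<in> QSym"
proof -
  obtain d where d: "\<And>m. coeff f m \<noteq> 0 \<Longrightarrow> degree m \<le> d" by (rule QSym_bounded[OF assms(1)]) blast
  obtain e where e: "\<And>m. coeff g m \<noteq> 0 \<Longrightarrow> degree m \<le> e" by (rule QSym_bounded[OF assms(2)]) blast
  show ?thesis
  proof (rule QSymI)
    show "degree m \<le> max d e" if "coeff (f + g) m \<noteq> 0" for m
    proof (cases "coeff f m = 0")
      case True
      then have "coeff g m \<noteq> 0" using that by (simp add: plus_power_series.rep_eq)
      then show ?thesis using e[of m] by simp
    next
      case False
      then show ?thesis using d[of m] by simp
    qed
  next
    show "coeff (f + g) (monomial is \<alpha>) = coeff (f + g) (monomial js \<alpha>)"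
      if "0 \<notin> set \<alpha>" "length is = length \<alpha>" "length js = length \<alpha>"
        "sorted_wrt (<) is" "sorted_wrt (<) js" for \<alpha> "is" js
      unfolding plus_power_series.rep_eq
      using QSym_quasisymmetric[OF assms(1) that] QSym_quasisymmetric[OF assms(2) that] by simp
  qed
qed

lemma scale_in_QSym:
  fixes f :: "'k::comm_ring power_series"
  assumes "f \<in> QSym"
  shows "c \<cdot> f \<in> QSym"
proof -
  obtain d where d: "\<And>m. coeff f m \<noteq> 0 \<Longrightarrow> degree m \<le> d" by (rule QSym_bounded[OF assms]) blast
  show ?thesis
  proof (rule QSymI)
    show "degree m \<le> d" if nz: "coeff (c \<cdot> f) m \<noteq> 0" for m
    proof (rule d, rule notI)
      assume "coeff f m = 0"
      then show False using nz by (simp add: scale.rep_eq)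
    qed
  next
    show "coeff (c \<cdot> f) (monomial is \<alpha>) = coeff (c \<cdot> f) (monomial js \<alpha>)"
      if "0 \<notin> set \<alpha>" "length is = length \<alpha>" "length js = length \<alpha>"
        "sorted_wrt (<) is" "sorted_wrt (<) js" for \<alpha> "is" js
      unfolding scale.rep_eq using QSym_quasisymmetric[OF assms that] by simp
  qed
qed

lemma sum_in_QSym:
  fixes f :: "'b \<Rightarrow> 'k::ab_group_add power_series"
  assumes "\<And>x. x \<in> A \<Longrightarrow> f x \<in> QSym"
  shows "sum f A \<in> QSym"
  using assms
  by (induction A rule: infinite_finite_induct) (simp_all add: zero_in_QSym add_in_QSym)

lemma eta_in_QSym: "eta q \<alpha> \<in> QSym"
  unfolding eta_def Let_def
  by (intro sum_in_QSym scale_in_QSym M_in_QSym[of _ "sum_list \<alpha>"]) simp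

end

theory Submission
  imports Defs
begin

text \<open>
  The identity is Moebius inversion on a Boolean lattice. The map \<open>D\<close> is a bijection from the
  compositions of \<open>n\<close> onto the subsets of \<open>{1..<n}\<close> (lemma \<open>bij_betw_D\<close>), so the definition of
  \<open>eta q \<alpha>\<close> is a sum over the subsets of \<open>D \<alpha>\<close>. Substituting it into the right-hand side and
  exchanging the two sums, the term \<open>r ^ length \<gamma> \<cdot> M \<gamma>\<close> acquires the coefficient
  \<open>\<Sum>\<alpha>. (-1) ^ (length \<beta> - length \<alpha>)\<close>, taken over the \<open>\<alpha>\<close> with
  \<open>D \<gamma> \<subseteq> D \<alpha> \<subseteq> D \<beta>\<close>,
  and the exponent is the number of elements of \<open>D \<beta> - D \<alpha>\<close>. This is an alternating sum over an
  interval of the Boolean lattice. It is \<open>1\<close> if the interval is a single point, that is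
  \<open>\<gamma> = \<beta>\<close>, and otherwise it vanishes, since inserting and removing a fixed element of
  \<open>D \<beta> - D \<gamma>\<close> pairs summands of opposite sign (lemma \<open>alternating_sum_Boolean_interval\<close>).
  Only the summand \<open>\<gamma> = \<beta>\<close> survives.
\<close>

section \<open>Compositions and subsets\<close>

lemma Comp_0: "Comp 0 = {[]}"
proof (intro set_eqI)
  show "\<alpha> \<in> Comp 0 \<longleftrightarrow> \<alpha> \<in> {[]}" for \<alpha>
    by (cases \<alpha>) (auto simp: Comp_def)
qed

lemma Nil_in_Comp_iff: "[] \<in> Comp n \<longleftrightarrow> n = 0"
  by (auto simp: Comp_def)

lemma snoc_in_Comp_iff: "\<alpha> @ [a] \<in> Comp n \<longleftrightarrow> \<alpha> \<in> Comp (sum_list \<alpha>) \<and> 0 < a \<and> sum_list \<alpha> + a = n"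
  by (auto simp: Comp_def)

lemma D_Nil [simp]: "D [] = {}"
  by (simp add: D_def)

lemma finite_D: "finite (D \<alpha>)"
  by (simp add: D_def)

text \<open>Compositions are built up from the right here: appending a part leaves the earlier partial
  sums alone, whereas prepending one would shift all of them.\<close>

lemma D_snoc: "D (\<alpha> @ [a]) = (if \<alpha> = [] then {} else insert (sum_list \<alpha>) (D \<alpha>))"
proof (cases "\<alpha> = []")
  case False
  then have "{1..length (\<alpha> @ [a]) - 1} = insert (length \<alpha>) {1..length \<alpha> - 1}"
    by (cases \<alpha>) auto
  moreover have D_image: "D \<gamma> = (\<lambda>i. sum_list (take i \<gamma>)) ` {1..length \<gamma> - 1}" for \<gamma>
    by (auto simp: D_def)
  ultimately have "D (\<alpha> @ [a]) = insert (sum_list (take (length \<alpha>) (\<alpha> @ [a])))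
      ((\<lambda>i. sum_list (take i (\<alpha> @ [a]))) ` {1..length \<alpha> - 1})"
    by (simp only: image_insert)
  also have "(\<lambda>i. sum_list (take i (\<alpha> @ [a]))) ` {1..length \<alpha> - 1} = D \<alpha>"
    unfolding D_image by (rule image_cong) auto
  finally show ?thesis
    using False by simp
qed (simp add: D_def)

lemma D_subset: "\<alpha> \<in> Comp n \<Longrightarrow> D \<alpha> \<subseteq> {1..<n}"
proof (induction \<alpha> arbitrary: n rule: rev_induct)
  case (snoc a \<alpha>)
  then have "\<alpha> \<in> Comp (sum_list \<alpha>)" "0 < a" "sum_list \<alpha> + a = n"
    by (simp_all add: snoc_in_Comp_iff)
  moreover have "0 < sum_list \<alpha>" if "\<alpha> \<noteq> []"
    using that \<open>\<alpha> \<in> Comp (sum_list \<alpha>)\<close> by (cases "sum_list \<alpha>") (simp_all add: Comp_0)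
  ultimately show ?case
    using snoc.IH[of "sum_list \<alpha>"] by (auto simp: D_snoc)
qed simp

text \<open>For \<open>\<alpha> \<noteq> []\<close>, the largest element of \<open>D (\<alpha> @ [a])\<close> is \<open>sum_list \<alpha>\<close>, so the set determines the last part
  and, after deleting this element, the set of the remaining composition.\<close>

lemma inj_on_D: "inj_on D (Comp n)"
proof (rule inj_onI)
  show "\<alpha> = \<beta>" if "\<alpha> \<in> Comp n" "\<beta> \<in> Comp n" "D \<alpha> = D \<beta>" for \<alpha> \<beta>
    using that
  proof (induction \<alpha> arbitrary: \<beta> n rule: rev_induct)
    case Nil
    then show ?case by (simp add: Nil_in_Comp_iff Comp_0)
  next
    case (snoc a \<alpha>)
    note \<alpha> = snoc.prems(1)[unfolded snoc_in_Comp_iff]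
    then have "\<beta> \<noteq> []" using snoc.prems(2) by (auto simp: Nil_in_Comp_iff)
    then obtain \<gamma> b where \<beta>: "\<beta> = \<gamma> @ [b]" by (metis rev_exhaust)
    note \<gamma> = snoc.prems(2)[unfolded \<beta> snoc_in_Comp_iff]
    note eq = snoc.prems(3)[unfolded \<beta> D_snoc]
    show ?case
    proof (cases "\<alpha> = [] \<or> \<gamma> = []")
      case True
      then have "\<alpha> = []" "\<gamma> = []" using eq by (auto split: if_splits)
      then show ?thesis using \<alpha> \<gamma> \<beta> by simp
    next
      case False
      then have ins: "insert (sum_list \<alpha>) (D \<alpha>) = insert (sum_list \<gamma>) (D \<gamma>)"
        using eq by simp
      have sub: "D \<alpha> \<subseteq> {1..<sum_list \<alpha>}" "D \<gamma> \<subseteq> {1..<sum_list \<gamma>}"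
        by (rule D_subset[OF conjunct1[OF \<alpha>]], rule D_subset[OF conjunct1[OF \<gamma>]])
      have sums: "sum_list \<alpha> = sum_list \<gamma>"
      proof (rule antisym)
        show "sum_list \<alpha> \<le> sum_list \<gamma>"
        proof -
          have "sum_list \<alpha> \<in> insert (sum_list \<gamma>) (D \<gamma>)" using ins by blast
          then show ?thesis using sub by auto
        qed
        show "sum_list \<gamma> \<le> sum_list \<alpha>"
        proof -
          have "sum_list \<gamma> \<in> insert (sum_list \<alpha>) (D \<alpha>)" using ins by blast
          then show ?thesis using sub by auto
        qed
      qed
      moreover have "sum_list \<alpha> \<notin> D \<alpha>" "sum_list \<gamma> \<notin> D \<gamma>" using sub by auto
      ultimately have "D \<alpha> = D \<gamma>" using ins by (metis insert_ident)
      then have "\<alpha> = \<gamma>" using snoc.IH[of "sum_list \<alpha>" \<gamma>] \<alpha> \<gamma> sums by simp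
      then show ?thesis using \<alpha> \<gamma> \<beta> by simp
    qed
  qed
qed

text \<open>A nonempty set with maximum \<open>m\<close> is realised by a composition of \<open>m\<close> for the elements
  below \<open>m\<close>, followed by the part \<open>n - m\<close>.\<close>

lemma subset_imp_ex_Comp:
  assumes "S \<subseteq> {1..<n}"
  shows "\<exists>\<alpha>\<in>Comp n. D \<alpha> = S"
  using assms
proof (induction n arbitrary: S rule: less_induct)
  case (less n)
  have fin: "finite S" using less.prems finite_subset by blast
  show ?case
  proof (cases "S = {}")
    case True
    have "(if n = 0 then [] else [n]) \<in> Comp n" "D (if n = 0 then [] else [n]) = S"
      using True by (auto simp: Comp_def D_def)
    then show ?thesis by blast
  next
    case False
    define m where "m = Max S"
    have m: "m \<in> S" "\<And>s. s \<in> S \<Longrightarrow> s \<le> m" using False fin by (simp_all add: m_def)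
    have mn: "0 < m" "m < n" using m(1) less.prems by auto
    have "S - {m} \<subseteq> {1..<m}"
    proof
      fix s assume s: "s \<in> S - {m}"
      then have "1 \<le> s" "s \<le> m" "s \<noteq> m" using less.prems m(2) by auto
      then show "s \<in> {1..<m}" by simp
    qed
    then obtain \<alpha> where \<alpha>: "\<alpha> \<in> Comp m" "D \<alpha> = S - {m}" using less.IH mn(2) by blast
    have sum: "sum_list \<alpha> = m" using \<alpha>(1) by (simp add: Comp_def)
    then have "\<alpha> \<noteq> []" using mn by auto
    then have "D (\<alpha> @ [n - m]) = S" using \<alpha>(2) m(1) sum by (auto simp: D_snoc)
    moreover have "\<alpha> @ [n - m] \<in> Comp n" using \<alpha>(1) mn sum by (simp add: snoc_in_Comp_iff)
    ultimately show ?thesis by blast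
  qed
qed

lemma bij_betw_D: "bij_betw D (Comp n) (Pow {1..<n})"
  unfolding bij_betw_def
proof
  show "inj_on D (Comp n)" by (rule inj_on_D)
  show "D ` Comp n = Pow {1..<n}"
  proof
    show "D ` Comp n \<subseteq> Pow {1..<n}" using D_subset by blast
    show "Pow {1..<n} \<subseteq> D ` Comp n" using subset_imp_ex_Comp by blast
  qed
qed

text \<open>Both lengths exceed the number of partial sums by one, except for the empty composition;
  but if one of the two compositions is empty, then \<open>n = 0\<close> and so is the other.\<close>

lemma length_diff_eq_card_D_diff:
  assumes "\<alpha> \<in> Comp n" "\<beta> \<in> Comp n" "D \<alpha> \<subseteq> D \<beta>"
  shows "length \<beta> - length \<alpha> = card (D \<beta> - D \<alpha>)"
proof -
  have "card (D \<beta> - D \<alpha>) = (length \<beta> - 1) - (length \<alpha> - 1)"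
    using assms by (simp add: card_Diff_subset finite_D card_D)
  moreover have "\<alpha> = [] \<longleftrightarrow> \<beta> = []"
    using assms by (metis Comp_0 Nil_in_Comp_iff singletonD)
  ultimately show ?thesis by (cases \<alpha>; cases \<beta>) auto
qed


section \<open>Alternating sums over Boolean intervals\<close>

text \<open>For \<open>S \<noteq> U\<close>, a fixed \<open>x \<in> U - S\<close> splits the interval into the sets avoiding \<open>x\<close> and the
  sets containing \<open>x\<close>. The map \<open>insert x\<close> is a bijection between the two halves and flips the
  sign.\<close>

lemma alternating_sum_Boolean_interval:
  assumes "finite U" "S \<subseteq> U"
  shows "(\<Sum>T\<in>{T. S \<subseteq> T \<and> T \<subseteq> U}. (-1) ^ card (U - T)) =
    (if S = U then 1 else 0 :: 'k::{comm_ring, comm_monoid_mult})"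
proof (cases "S = U")
  case True
  then have "{T. S \<subseteq> T \<and> T \<subseteq> U} = {U}" by auto
  then show ?thesis using True by simp
next
  case False
  then obtain x where x: "x \<in> U" "x \<notin> S" using assms(2) by blast
  define A where "A = {T. S \<subseteq> T \<and> T \<subseteq> U - {x}}"
  have split: "{T. S \<subseteq> T \<and> T \<subseteq> U} = A \<union> insert x ` A"
  proof (intro set_eqI iffI)
    fix T assume T: "T \<in> {T. S \<subseteq> T \<and> T \<subseteq> U}"
    show "T \<in> A \<union> insert x ` A"
    proof (cases "x \<in> T")
      case True
      then have "T = insert x (T - {x})" "T - {x} \<in> A" using T x by (auto simp: A_def)
      then show ?thesis by blast
    qed (use T in \<open>auto simp: A_def\<close>)
  qed (use x in \<open>auto simp: A_def\<close>)
  have "A \<subseteq> Pow U" by (auto simp: A_def)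
  then have fin: "finite A" using assms(1) by (simp add: finite_subset)
  have disj: "A \<inter> insert x ` A = {}" by (auto simp: A_def)
  have inj: "inj_on (insert x) A"
    by (rule inj_onI) (auto simp: A_def insert_ident subset_Diff_insert)
  have flip: "(-1) ^ card (U - T) = - ((-1) ^ card (U - insert x T) :: 'k)" if "T \<in> A" for T
  proof -
    have "U - T = insert x (U - insert x T)" using that x by (auto simp: A_def)
    then have "card (U - T) = card (insert x (U - insert x T))" by (rule arg_cong)
    also have "\<dots> = Suc (card (U - insert x T))"
      by (rule card_insert_disjoint) (use assms(1) in auto)
    finally have "card (U - T) = Suc (card (U - insert x T))" .
    then show ?thesis by (simp only: power_Suc mult_minus_left mult_1_left)
  qed
  have "(\<Sum>T\<in>A \<union> insert x ` A. (-1) ^ card (U - T)) =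
      (\<Sum>T\<in>A. (-1) ^ card (U - T)) + (\<Sum>T\<in>A. (-1) ^ card (U - insert x T) :: 'k)"
    using fin disj by (simp add: sum.union_disjoint sum.reindex[OF inj])
  also have "\<dots> = 0"
    by (simp only: flip sum_negf add.left_inverse cong: sum.cong)
  finally show ?thesis using split False by simp
qed

lemma alternating_sum_Comp_interval:
  assumes "\<beta> \<in> Comp n" "\<gamma> \<in> Comp n" "D \<gamma> \<subseteq> D \<beta>"
  shows "(\<Sum>\<alpha>\<in>{\<alpha> \<in> Comp n. D \<gamma> \<subseteq> D \<alpha> \<and> D \<alpha> \<subseteq> D \<beta>}. (-1) ^ (length \<beta> - length \<alpha>)) =
    (if \<gamma> = \<beta> then 1 else 0 :: 'k::{comm_ring, comm_monoid_mult})"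
proof -
  let ?I = "{\<alpha> \<in> Comp n. D \<gamma> \<subseteq> D \<alpha> \<and> D \<alpha> \<subseteq> D \<beta>}"
  let ?J = "{T. D \<gamma> \<subseteq> T \<and> T \<subseteq> D \<beta>}"
  have "?J \<subseteq> D ` ?I"
  proof
    fix T assume T: "T \<in> ?J"
    then have "T \<in> D ` Comp n"
      using D_subset[OF assms(1)] bij_betw_D[of n] by (auto simp: bij_betw_def)
    then show "T \<in> D ` ?I" using T by auto
  qed
  moreover have "inj_on D ?I" by (rule inj_on_subset[OF inj_on_D]) auto
  ultimately have bij: "bij_betw D ?I ?J" by (auto simp: bij_betw_def)
  have "(\<Sum>\<alpha>\<in>?I. (-1) ^ (length \<beta> - length \<alpha>)) = (\<Sum>\<alpha>\<in>?I. (-1) ^ card (D \<beta> - D \<alpha>) :: 'k)"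
    by (rule sum.cong) (use assms(1) in \<open>auto simp: length_diff_eq_card_D_diff\<close>)
  also have "\<dots> = (\<Sum>T\<in>?J. (-1) ^ card (D \<beta> - T))"
    by (rule sum.reindex_bij_betw[OF bij])
  also have "\<dots> = (if D \<gamma> = D \<beta> then 1 else 0)"
    by (rule alternating_sum_Boolean_interval[OF finite_D assms(3)])
  also have "D \<gamma> = D \<beta> \<longleftrightarrow> \<gamma> = \<beta>"
    using inj_on_eq_iff[OF inj_on_D] assms(1,2) by blast
  finally show ?thesis .
qed


section \<open>Linear combinations of power series\<close>

lemma scale_scale: "a \<cdot> b \<cdot> f = (a * b) \<cdot> f" for f :: "'k::semigroup_mult power_series"
  by transfer (simp add: mult.assoc)

lemma scale_one: "1 \<cdot> f = f" for f :: "'k::monoid_mult power_series"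
  by transfer simp

lemma scale_zero_left: "0 \<cdot> f = 0" for f :: "'k::ring power_series"
  by transfer simp

lemma scale_zero_right: "c \<cdot> 0 = 0" for c :: "'k::ring"
  by transfer simp

lemma scale_add_left: "(a + b) \<cdot> f = a \<cdot> f + b \<cdot> f" for f :: "'k::ring power_series"
  by transfer (simp add: distrib_right)

lemma scale_add_right: "c \<cdot> (f + g) = c \<cdot> f + c \<cdot> g" for f :: "'k::ring power_series"
  by transfer (simp add: distrib_left)

lemma scale_sum_left: "(\<Sum>x\<in>A. c x) \<cdot> f = (\<Sum>x\<in>A. c x \<cdot> f)" for f :: "'k::ring power_series"
  by (induction A rule: infinite_finite_induct) (simp_all add: scale_zero_left scale_add_left)

lemma scale_sum_right: "c \<cdot> (\<Sum>x\<in>A. f x) = (\<Sum>x\<in>A. c \<cdot> f x)" for c :: "'k::ring"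
  by (induction A rule: infinite_finite_induct) (simp_all add: scale_zero_right scale_add_right)


section \<open>The inversion formula\<close>

theorem proposition3p6:
  fixes q r :: "'k :: {comm_ring, comm_monoid_mult}"
    and n :: nat and \<beta> :: "nat list"
  assumes "r = q + 1"
    and "\<beta> \<in> Comp n"
  shows "r ^ length \<beta> \<cdot> M \<beta> =
    (\<Sum>\<alpha>\<in>{\<alpha> \<in> Comp n. D \<alpha> \<subseteq> D \<beta>}. (-1) ^ (length \<beta> - length \<alpha>) \<cdot> eta q \<alpha>)"
proof -
  define m :: "nat list \<Rightarrow> 'k power_series" where "m \<gamma> = r ^ length \<gamma> \<cdot> M \<gamma>" for \<gamma>
  define s :: "nat list \<Rightarrow> 'k" where "s \<alpha> = (-1) ^ (length \<beta> - length \<alpha>)" for \<alpha>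
  let ?B = "{\<alpha> \<in> Comp n. D \<alpha> \<subseteq> D \<beta>}"
  have fin: "finite ?B" by (simp add: finite_Comp)
  have eta: "eta q \<alpha> = (\<Sum>\<gamma>\<in>{\<gamma> \<in> Comp n. D \<gamma> \<subseteq> D \<alpha>}. m \<gamma>)" if "\<alpha> \<in> Comp n" for \<alpha>
    using that assms(1) by (simp add: eta_def m_def Comp_def)
  \<comment> \<open>Every \<open>\<gamma>\<close> that occurs lies below \<open>\<beta>\<close>, so both indices can be taken from \<open>?B\<close> and the
    sums exchange.\<close>
  have "(\<Sum>\<alpha>\<in>?B. s \<alpha> \<cdot> eta q \<alpha>) = (\<Sum>\<alpha>\<in>?B. \<Sum>\<gamma>\<in>{\<gamma> \<in> ?B. D \<gamma> \<subseteq> D \<alpha>}. s \<alpha> \<cdot> m \<gamma>)"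
  proof (rule sum.cong[OF refl])
    fix \<alpha> assume \<alpha>: "\<alpha> \<in> ?B"
    then have "{\<gamma> \<in> Comp n. D \<gamma> \<subseteq> D \<alpha>} = {\<gamma> \<in> ?B. D \<gamma> \<subseteq> D \<alpha>}" by auto
    then show "s \<alpha> \<cdot> eta q \<alpha> = (\<Sum>\<gamma>\<in>{\<gamma> \<in> ?B. D \<gamma> \<subseteq> D \<alpha>}. s \<alpha> \<cdot> m \<gamma>)"
      using \<alpha> by (simp add: eta scale_sum_right)
  qed
  also have "\<dots> = (\<Sum>\<gamma>\<in>?B. \<Sum>\<alpha>\<in>{\<alpha> \<in> ?B. D \<gamma> \<subseteq> D \<alpha>}. s \<alpha> \<cdot> m \<gamma>)"
    by (rule sum.swap_restrict[OF fin fin])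
  also have "\<dots> = (\<Sum>\<gamma>\<in>?B. if \<gamma> = \<beta> then m \<gamma> else 0)"
  proof (rule sum.cong[OF refl])
    fix \<gamma> assume \<gamma>: "\<gamma> \<in> ?B"
    have "{\<alpha> \<in> ?B. D \<gamma> \<subseteq> D \<alpha>} = {\<alpha> \<in> Comp n. D \<gamma> \<subseteq> D \<alpha> \<and> D \<alpha> \<subseteq> D \<beta>}" by auto
    then have "(\<Sum>\<alpha>\<in>{\<alpha> \<in> ?B. D \<gamma> \<subseteq> D \<alpha>}. s \<alpha>) = (if \<gamma> = \<beta> then 1 else 0)"
      using alternating_sum_Comp_interval[OF assms(2), of \<gamma>] \<gamma> by (simp add: s_def)
    then show "(\<Sum>\<alpha>\<in>{\<alpha> \<in> ?B. D \<gamma> \<subseteq> D \<alpha>}. s \<alpha> \<cdot> m \<gamma>) = (if \<gamma> = \<beta> then m \<gamma> else 0)"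
      by (simp add: scale_sum_left[symmetric] scale_one scale_zero_left)
  qed
  also have "\<dots> = m \<beta>"
    using fin assms(2) by simp
  finally show ?thesis by (simp add: m_def s_def)
qed

end
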